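(* Let $\gamma\in(0,1)$, $\tau\in[0,1-\gamma)$, and $c_0=c_0(\gamma,\tau)=\frac{1+\gamma+\tau}{1-\gamma-\tau}$. Let $\lambda_j=A\sigma\sqrt{\log(2p/j)/n}$, $j=1,\dots,p$, with a constant $A\ge(4+\sqrt2)/\gamma$. Let $\delta_0\in(0,1)$ and consider the event $$\Omega=\Big\{\tfrac1n\boldsymbol\xi^T\mathbb X\boldsymbol u\le\max\big(H(\boldsymbol u),G(\boldsymbol u)\big)\ \ \forall\boldsymbol u\in\mathbb R^p\Big\}.$$ For $s=1,\dots,p$ set $$C'_{\gamma,\tau}(s,\delta_0)=(1+\gamma+\tau)^2\left(\frac{\log(1/\delta_0)}{s\log(2p/s)}\vee\frac1{\vartheta^2(s,c_0(\gamma,\tau))}\right)$$ if $WRE(s,c_0(\gamma,\tau))$ holds, and $C'_{\gamma,\tau}(s,\delta_0)=\infty$ otherwise. Then, on the event $\Omega$, the Slope estimator $\hat{\boldsymbol\beta}$ with weights $\lambda_1,\dots,\lambda_p$ satisfies $$2\tau|\hat{\boldsymbol\beta}-\boldsymbol\beta|_*+\|\mathbb X\hat{\boldsymbol\beta}-\mathbf f\|_n^2\le\|\mathbb X\boldsymbol\beta-\mathbf f\|_n^2+C'_{\gamma,\tau}(s,\delta_0)\sum_{j=1}^s\lambda_j^2$$ simultaneously for all $\mathbf f\in\mathbb R^n$, all $s=1,\dots,p$, and all $\boldsymbol\beta\in\mathbb R^p$ such that $|\boldsymbol\beta|_0=s$. Furthermore, let $s\in\{1,\dots,p\}$; if $\mathbf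 f=\mathbb X\boldsymbol\beta^*$ for some $\boldsymbol\beta^*\in\mathbb R^p$ with $|\boldsymbol\beta^*|_0\le s$, then on the event $\Omega$, $$2\tau|\hat{\boldsymbol\beta}-\boldsymbol\beta^*|_*\le C'_{\gamma,\tau}(s,\delta_0)\sum_{j=1}^s\lambda_j^2,\qquad|\hat{\boldsymbol\beta}-\boldsymbol\beta^*|_2\le\frac{C'_{\gamma,0}(s,\delta_0)}{1+\gamma}\Big(\sum_{j=1}^s\lambda_j^2\Big)^{1/2}.$$
   Context: Let $n,p\ge1$ be integers, $\sigma>0$, and let $\mathbb X\in\mathbb R^{n\times p}$ be a deterministic matrix with $\|\mathbb X\boldsymbol e_j\|_n\le1$ for all $j$, where $(\boldsymbol e_j)$ is the canonical basis of $\mathbb R^p$ and $\|\boldsymbol u\|_n^2=\frac1n\sum_{i=1}^nu_i^2$. Let $\mathbf f\in\mathbb R^n$ be deterministic, $\boldsymbol\xi\sim\mathcal N(\mathbf 0,\sigma^2I_{n\times n})$, $\mathbf y=\mathbf f+\boldsymbol\xi$. $|\cdot|_q$ is the $\ell_q$ norm on $\mathbb R^p$, $|\boldsymbol\beta|_0$ the number of nonzero components, $a\vee b=\max(a,b)$. For $\boldsymbol u\in\mathbb R^p$, $u_1^\sharp\ge\dots\ge u_p^\sharp$ is a non-increasing rearrangement of $|u_1|,\dots,|u_p|$. Sorted $\ell_1$ norm: $|\boldsymbol\beta|_*=\sum_{j=1}^p\lambda_j\beta_j^\sharp$. Slope estimator with weights $\lambda_1\ge\dots\ge\lambda_p\ge0$: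 any $\hat{\boldsymbol\beta}\in\arg\min_{\boldsymbol\beta\in\mathbb R^p}\big(\|\mathbb X\boldsymbol\beta-\mathbf y\|_n^2+2|\boldsymbol\beta|_*\big)$. Condition $WRE(s,c_0)$ ($c_0>0$, with the weights $\lambda_j$): $\|\mathbb X\boldsymbol e_j\|_n\le1$ for all $j=1,\dots,p$, and $$\vartheta(s,c_0)=\min_{\boldsymbol\delta\in\mathcal C_{WRE}(s,c_0),\,\boldsymbol\delta\ne\mathbf 0}\frac{\|\mathbb X\boldsymbol\delta\|_n}{|\boldsymbol\delta|_2}>0,\qquad\mathcal C_{WRE}(s,c_0)=\Big\{\boldsymbol\delta\in\mathbb R^p:|\boldsymbol\delta|_*\le(1+c_0)|\boldsymbol\delta|_2\sqrt{\textstyle\sum_{j=1}^s\lambda_j^2}\Big\}.$$ For $\delta_0\in(0,1)$ and $\boldsymbol u\in\mathbb R^p$, $$H(\boldsymbol u)=(4+\sqrt2)\sum_{j=1}^pu_j^\sharp\,\sigma\sqrt{\frac{\log(2p/j)}n},\qquad G(\boldsymbol u)=(4+\sqrt2)\,\sigma\sqrt{\frac{\log(1/\delta_0)}n}\,\|\mathbb X\boldsymbol u\|_n.$$ *)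

theory Defs
  imports "HOL-Probability.Probability"
begin

text \<open>
  The dimensions are \<open>n = CARD('n)\<close> and \<open>p = CARD('p)\<close>; the Euclidean norm on
  \<open>real ^ 'p\<close> is the library's \<open>norm\<close>. Weights are functions on \<open>nat\<close> of which only the
  values at \<open>1, ..., p\<close> matter.
\<close>

definition emp_norm :: "real ^ 'n \<Rightarrow> real" where
  "emp_norm u = sqrt ((1 / real CARD('n)) * (\<Sum>i\<in>UNIV. (u $ i)\<^sup>2))"

definition l0 :: "real ^ 'p \<Rightarrow> nat" where
  "l0 \<beta> = card {j. \<beta> $ j \<noteq> 0}"

text \<open>Positions in the rearrangement count from 1; \<open>sharp u j\<close> is meant for \<open>1 \<le> j \<le> p\<close>.\<close>

definition sharp :: "real ^ 'p \<Rightarrow> nat \<Rightarrow> real" where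
  "sharp u j =
     rev (sorted_list_of_multiset (image_mset (\<lambda>k. \<bar>u $ k\<bar>) (mset_set (UNIV :: 'p set)))) ! (j - 1)"

definition sorted_l1 :: "(nat \<Rightarrow> real) \<Rightarrow> real ^ 'p \<Rightarrow> real" where
  "sorted_l1 lam \<beta> = (\<Sum>j = 1..CARD('p). lam j * sharp \<beta> j)"

definition is_slope_estimator ::
  "(nat \<Rightarrow> real) \<Rightarrow> real ^ 'p ^ 'n \<Rightarrow> real ^ 'n \<Rightarrow> real ^ 'p \<Rightarrow> bool" where
  "is_slope_estimator lam X y b \<longleftrightarrow>
     is_arg_min (\<lambda>\<beta>. (emp_norm (X *v \<beta> - y))\<^sup>2 + 2 * sorted_l1 lam \<beta>) (\<lambda>_. True) b"

definition cone_WRE :: "(nat \<Rightarrow> real) \<Rightarrow> nat \<Rightarrow> real \<Rightarrow> (real ^ 'p) set" where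
  "cone_WRE lam s c0 =
     {\<delta>. sorted_l1 lam \<delta> \<le> (1 + c0) * norm \<delta> * sqrt (\<Sum>j = 1..s. (lam j)\<^sup>2)}"

text \<open>
  The infimum below is a minimum: the quotient is continuous and invariant under positive
  scaling, so it may be taken over the intersection of the closed cone with the unit sphere,
  which is compact; for \<open>s \<ge> 1\<close>, \<open>c0 > 0\<close> and \<open>lam 1 \<ge> 0\<close> that intersection contains
  the basis vectors.
\<close>

definition vartheta :: "real ^ 'p ^ 'n \<Rightarrow> (nat \<Rightarrow> real) \<Rightarrow> nat \<Rightarrow> real \<Rightarrow> real" where
  "vartheta X lam s c0 =
     (INF \<delta> \<in> cone_WRE lam s c0 - {0}. emp_norm (X *v \<delta>) / norm \<delta>)"

definition WRE :: "real ^ 'p ^ 'n \<Rightarrow> (nat \<Rightarrow> real) \<Rightarrow> nat \<Rightarrow> real \<Rightarrow> bool" where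
  "WRE X lam s c0 \<longleftrightarrow>
     (\<forall>j. emp_norm (X *v axis j 1) \<le> 1) \<and> vartheta X lam s c0 > 0"

definition H_fun :: "real \<Rightarrow> real ^ 'p ^ 'n \<Rightarrow> real ^ 'p \<Rightarrow> real" where
  "H_fun \<sigma> X u = (4 + sqrt 2) *
     (\<Sum>j = 1..CARD('p). sharp u j * \<sigma> * sqrt (ln (2 * real CARD('p) / real j) / real CARD('n)))"

definition G_fun :: "real \<Rightarrow> real \<Rightarrow> real ^ 'p ^ 'n \<Rightarrow> real ^ 'p \<Rightarrow> real" where
  "G_fun \<sigma> \<delta>0 X u =
     (4 + sqrt 2) * \<sigma> * sqrt (ln (1 / \<delta>0) / real CARD('n)) * emp_norm (X *v u)"

definition c0_const :: "real \<Rightarrow> real \<Rightarrow> real" where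
  "c0_const \<gamma> \<tau> = (1 + \<gamma> + \<tau>) / (1 - \<gamma> - \<tau>)"

definition C_const ::
  "real ^ 'p ^ 'n \<Rightarrow> (nat \<Rightarrow> real) \<Rightarrow> real \<Rightarrow> real \<Rightarrow> nat \<Rightarrow> real \<Rightarrow> ereal" where
  "C_const X lam \<gamma> \<tau> s \<delta>0 =
     (if WRE X lam s (c0_const \<gamma> \<tau>)
      then ereal ((1 + \<gamma> + \<tau>)\<^sup>2 *
             max (ln (1 / \<delta>0) / (real s * ln (2 * real CARD('p) / real s)))
                 (1 / (vartheta X lam s (c0_const \<gamma> \<tau>))\<^sup>2))
      else \<infinity>)"

text \<open>The law \<open>N(0, \<sigma>\<^sup>2 I)\<close>, given by its density with respect to Lebesgue measure; needs \<open>\<sigma> > 0\<close>.\<close>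

definition gaussian_noise :: "'w measure \<Rightarrow> real \<Rightarrow> ('w \<Rightarrow> real ^ 'n) \<Rightarrow> bool" where
  "gaussian_noise M \<sigma> \<xi> \<longleftrightarrow>
     distributed M lborel \<xi> (\<lambda>x. ennreal (\<Prod>i\<in>UNIV. normal_density 0 \<sigma> (x $ i)))"

end

theory Submission
  imports Defs
begin

text \<open>
  The argument is deterministic: everything happens at a fixed outcome of the event. Put
  \<open>u = bhat - \<beta>\<close>, \<open>c = 1 + \<gamma> + \<tau>\<close> and \<open>S = (\<Sum>j = 1..s. (lam j)\<^sup>2)\<close>, and write \<open>|u|*\<close> for the
  sorted l1 norm and \<open>w = emp_norm (X *v u)\<close>. Comparing the minimiser with points of the segment
  towards \<open>\<beta>\<close> (\<open>slope_basic_inequality\<close>) gives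
  \<open>2 \<tau> |u|* + emp_norm (X *v bhat - f)\<^sup>2 \<le> emp_norm (X *v \<beta> - f)\<^sup>2 + 2 D - w\<^sup>2\<close>, where
  \<open>D = N + \<tau> |u|* + |\<beta>|* - |bhat|*\<close> and \<open>N\<close> is the noise term. On the event, \<open>A \<ge> (4 + sqrt 2) / \<gamma>\<close>
  turns the bound on \<open>N\<close> into \<open>N \<le> \<gamma> max(|u|*, B w)\<close> with \<open>B = A \<sigma> sqrt (ln (1 / \<delta>0) / n)\<close>.

  The proof then splits on which term of this maximum is larger (\<open>noise_dichotomy\<close>). If
  \<open>|u|* \<le> B w\<close>, the triangle inequality gives \<open>D \<le> c B w\<close>. Otherwise sparsity of \<open>\<beta>\<close> enters through
  \<open>sparse_sorted_l1_diff_le\<close>: \<open>|\<beta>|* - |bhat|*\<close> is at most the first \<open>s\<close> terms of \<open>|u|*\<close> minus the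
  remaining ones. So \<open>D \<le> c hd - (1 - \<gamma> - \<tau>) tl\<close>, where \<open>hd\<close> and \<open>tl\<close> are the two parts of \<open>|u|*\<close>
  and \<open>hd \<le> norm u * sqrt S\<close> by Cauchy-Schwarz. If \<open>D \<ge> 0\<close> (a negative \<open>D\<close> only helps), this puts \<open>u\<close> in the cone of the
  restricted eigenvalue condition, whence \<open>norm u \<le> w / vartheta\<close> and \<open>D \<le> c (w / vartheta) sqrt S\<close>.
  In both cases \<open>2 a w - w\<^sup>2 \<le> a\<^sup>2\<close> removes \<open>w\<close> (\<open>prediction_excess_le\<close>). The two maximands of the
  constant correspond to the two cases, the first one because \<open>S\<close> is at least \<open>s\<close> times its last
  summand, which gives \<open>B\<^sup>2 \<le> S ln (1 / \<delta>0) / (s ln (2 p / s))\<close>.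

  For \<open>f = X *v \<beta>\<close> and \<open>\<tau> = 0\<close> the basic inequality reads \<open>w\<^sup>2 \<le> D\<close>, which bounds \<open>w\<close> itself and
  leads to the bound on \<open>norm u\<close> (\<open>estimation_error_le\<close>).
\<close>

section \<open>The non-increasing rearrangement\<close>

text \<open>
  A bijection of positions with indices carries all later work, since sums over positions can
  then be re-indexed. It is read off a list of all indices sorted by decreasing absolute value.
\<close>

lemma sharp_sorting_bijection:
  fixes u :: "real ^ 'p"
  obtains \<pi> where "bij_betw \<pi> {1..CARD('p)} (UNIV :: 'p set)"
    and "\<And>j. j \<in> {1..CARD('p)} \<Longrightarrow> sharp u j = \<bar>u $ \<pi> j\<bar>"
    and "\<And>i j. 1 \<le> i \<Longrightarrow> i \<le> j \<Longrightarrow> j \<le> CARD('p) \<Longrightarrow> sharp u j \<le> sharp u i"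
proof -
  obtain ks :: "'p list" where ks: "set ks = UNIV" "distinct ks"
    using finite_distinct_list[of "UNIV :: 'p set"] by auto
  let ?a = "\<lambda>k. \<bar>u $ k\<bar>"
  define zs where "zs = rev (sort_key ?a ks)"
  have zs: "set zs = UNIV" "distinct zs" using ks by (simp_all add: zs_def)
  have len: "length zs = CARD('p)" using zs distinct_card[of zs] by simp
  have "mset_set (UNIV :: 'p set) = mset (sort_key ?a ks)"
    using ks mset_set_set[of ks] by simp
  then have "image_mset ?a (mset_set UNIV) = mset (map ?a (sort_key ?a ks))"
    by simp
  then have "sorted_list_of_multiset (image_mset ?a (mset_set UNIV)) = map ?a (sort_key ?a ks)"
    by (simp only: sorted_list_of_multiset_mset) (simp add: sort_key_id_if_sorted)
  then have sh: "sharp u j = map ?a zs ! (j - 1)" for j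
    by (simp add: sharp_def zs_def rev_map)
  have shr: "sharp u j = \<bar>u $ (zs ! (j - 1))\<bar>" if "j \<in> {1..CARD('p)}" for j
    using that len sh by (subst sh, subst nth_map) auto
  have bij0: "bij_betw ((!) zs) {..<CARD('p)} UNIV"
    using bij_betw_nth[OF zs(2) _ zs(1)[symmetric]] len by simp
  have "bij_betw (\<lambda>j. j - 1) {1..CARD('p)} {..<CARD('p)}"
    by (rule bij_betw_byWitness[where f' = Suc]) auto
  then have bij: "bij_betw (\<lambda>j. zs ! (j - 1)) {1..CARD('p)} UNIV"
    using bij_betw_trans[OF _ bij0] by (simp add: o_def)
  have srt: "sorted (map ?a (rev zs))" by (simp add: zs_def)
  have anti: "sharp u j \<le> sharp u i" if "1 \<le> i" "i \<le> j" "j \<le> CARD('p)" for i j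
  proof -
    have "sorted (rev (map ?a zs))" using srt by (simp add: rev_map)
    from sorted_rev_nth_mono[OF this, of "i - 1" "j - 1"] that len
    show ?thesis by (simp only: sh) (simp add: diff_le_mono)
  qed
  show ?thesis by (rule that[OF bij shr anti])
qed

lemma sharp_antimono:
  fixes u :: "real ^ 'p"
  assumes "1 \<le> i" "i \<le> j" "j \<le> CARD('p)"
  shows "sharp u j \<le> sharp u i"
  using sharp_sorting_bijection[of u] assms by metis

lemma sharp_nonneg:
  fixes u :: "real ^ 'p"
  assumes "j \<in> {1..CARD('p)}"
  shows "0 \<le> sharp u j"
  using sharp_sorting_bijection[of u] assms abs_ge_zero by metis

lemma sum_sharp:
  fixes u :: "real ^ 'p"
  shows "(\<Sum>j = 1..CARD('p). h (sharp u j)) = (\<Sum>i\<in>UNIV. h \<bar>u $ i\<bar>)"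
proof -
  obtain \<pi> where \<pi>: "bij_betw \<pi> {1..CARD('p)} (UNIV :: 'p set)"
    "\<And>j. j \<in> {1..CARD('p)} \<Longrightarrow> sharp u j = \<bar>u $ \<pi> j\<bar>"
    by (rule sharp_sorting_bijection[of u]) blast
  have "(\<Sum>j = 1..CARD('p). h (sharp u j)) = (\<Sum>j = 1..CARD('p). h \<bar>u $ \<pi> j\<bar>)"
    using \<pi>(2) by simp
  also have "\<dots> = (\<Sum>i\<in>UNIV. h \<bar>u $ i\<bar>)"
    using sum.reindex_bij_betw[OF \<pi>(1), of "\<lambda>i. h \<bar>u $ i\<bar>"] by simp
  finally show ?thesis .
qed

lemma sum_sharp_squares:
  fixes u :: "real ^ 'p"
  shows "(\<Sum>j = 1..CARD('p). (sharp u j)\<^sup>2) = (norm u)\<^sup>2"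
  using sum_sharp[of "\<lambda>x. x\<^sup>2" u]
  by (simp add: power2_norm_eq_inner inner_vec_def) (simp add: power2_eq_square)

text \<open>
  A set of \<open>k\<close> entries carries no more mass than the \<open>k\<close> largest ones. After subtracting from every
  entry the \<open>k\<close>-th largest value, each sum can be compared with the sum of positive parts.
\<close>

lemma sum_abs_le_sum_sharp:
  fixes u :: "real ^ 'p"
  shows "(\<Sum>i\<in>S. \<bar>u $ i\<bar>) \<le> (\<Sum>j = 1..card S. sharp u j)"
proof (cases "S = {}")
  case False
  define k where "k = card S"
  have kp: "1 \<le> k" "k \<le> CARD('p)"
    using False by (auto simp: k_def card_gt_0_iff Suc_le_eq card_mono)
  \<comment> \<open>Only the first \<open>k\<close> positions can exceed the \<open>k\<close>-th largest value.\<close>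
  define t where "t = sharp u k"
  have "(\<Sum>i\<in>S. \<bar>u $ i\<bar> - t) \<le> (\<Sum>i\<in>S. max 0 (\<bar>u $ i\<bar> - t))"
    by (intro sum_mono) simp
  also have "\<dots> \<le> (\<Sum>i\<in>UNIV. max 0 (\<bar>u $ i\<bar> - t))"
    by (intro sum_mono2) auto
  also have "\<dots> = (\<Sum>j = 1..CARD('p). max 0 (sharp u j - t))"
    by (rule sum_sharp[of "\<lambda>x. max 0 (x - t)" u, symmetric])
  also have "\<dots> = (\<Sum>j = 1..k. max 0 (sharp u j - t))"
    using kp by (intro sum.mono_neutral_right) (auto simp: t_def max_absorb1 sharp_antimono)
  also have "\<dots> = (\<Sum>j = 1..k. sharp u j - t)"
    using kp by (intro sum.cong refl) (auto simp: t_def max_absorb2 sharp_antimono)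
  finally show ?thesis by (simp add: sum_subtractf k_def)
qed simp

section \<open>The sorted l1 norm\<close>

definition slope_weights :: "nat \<Rightarrow> (nat \<Rightarrow> real) \<Rightarrow> bool" where
  "slope_weights p lam \<longleftrightarrow>
     (\<forall>j\<in>{1..p}. 0 \<le> lam j) \<and> (\<forall>i j. 1 \<le> i \<longrightarrow> i \<le> j \<longrightarrow> j \<le> p \<longrightarrow> lam j \<le> lam i)"

text \<open>
  Summation by parts in inductive form: as long as the partial sums of \<open>c\<close> are nonnegative,
  replacing all weights by the smallest one can only decrease the sum.
\<close>

lemma abel_lower_bound:
  fixes lam c :: "nat \<Rightarrow> real"
  assumes "1 \<le> m" "slope_weights m lam"
    and "\<And>k. k \<le> m \<Longrightarrow> 0 \<le> (\<Sum>j = 1..k. c j)"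
  shows "lam m * (\<Sum>j = 1..m. c j) \<le> (\<Sum>j = 1..m. lam j * c j)"
  using assms
proof (induction m rule: nat_induct_at_least)
  case base
  then show ?case by simp
next
  case (Suc m)
  have "slope_weights m lam" using Suc.prems(1) by (auto simp: slope_weights_def)
  then have "lam m * (\<Sum>j = 1..m. c j) \<le> (\<Sum>j = 1..m. lam j * c j)"
    using Suc.IH Suc.prems(2) by simp
  moreover have "lam (Suc m) * (\<Sum>j = 1..m. c j) \<le> lam m * (\<Sum>j = 1..m. c j)"
    using Suc.prems Suc.hyps by (intro mult_right_mono) (auto simp: slope_weights_def)
  ultimately show ?case by (simp add: distrib_left)
qed

text \<open>
  Equality holds when \<open>\<phi>\<close> sorts \<open>u\<close>, so the sorted l1 norm is a maximum, over all bijections, of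
  weighted l1 norms. This is why it is a norm, and why any convenient ordering of the indices gives
  a lower bound for it.
\<close>

lemma rearrangement_le_sorted_l1:
  fixes u :: "real ^ 'p"
  assumes lam: "slope_weights CARD('p) lam"
    and \<phi>: "bij_betw \<phi> {1..CARD('p)} (UNIV :: 'p set)"
  shows "(\<Sum>j = 1..CARD('p). lam j * \<bar>u $ \<phi> j\<bar>) \<le> sorted_l1 lam u"
proof -
  let ?p = "CARD('p)"
  let ?c = "\<lambda>j. sharp u j - \<bar>u $ \<phi> j\<bar>"
  have p1: "1 \<le> ?p" by (simp add: Suc_le_eq)
  have part: "0 \<le> (\<Sum>j = 1..k. ?c j)" if "k \<le> ?p" for k
  proof -
    have inj: "inj_on \<phi> {1..k}"
      using bij_betw_imp_inj_on[OF \<phi>] by (rule inj_on_subset) (use that in auto)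
    have "(\<Sum>j = 1..k. \<bar>u $ \<phi> j\<bar>) = (\<Sum>i\<in>\<phi> ` {1..k}. \<bar>u $ i\<bar>)"
      using sum.reindex[OF inj, of "\<lambda>i. \<bar>u $ i\<bar>"] by (simp only: o_def)
    also have "\<dots> \<le> (\<Sum>j = 1..k. sharp u j)"
      using sum_abs_le_sum_sharp[of u "\<phi> ` {1..k}"] card_image[OF inj] by simp
    finally show ?thesis by (simp add: sum_subtractf)
  qed
  have "0 \<le> lam ?p * (\<Sum>j = 1..?p. ?c j)"
    using lam p1 part[of ?p] by (intro mult_nonneg_nonneg) (auto simp: slope_weights_def)
  also have "\<dots> \<le> (\<Sum>j = 1..?p. lam j * ?c j)"
    by (rule abel_lower_bound[OF p1 lam part])
  finally show ?thesis
    by (simp add: sorted_l1_def right_diff_distrib sum_subtractf)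
qed

lemma sorted_l1_nonneg:
  fixes u :: "real ^ 'p"
  assumes "slope_weights CARD('p) lam"
  shows "0 \<le> sorted_l1 lam u"
  unfolding sorted_l1_def
  using assms by (intro sum_nonneg mult_nonneg_nonneg sharp_nonneg) (auto simp: slope_weights_def)

lemma sorted_l1_triangle:
  fixes u v :: "real ^ 'p"
  assumes lam: "slope_weights CARD('p) lam"
  shows "sorted_l1 lam (u + v) \<le> sorted_l1 lam u + sorted_l1 lam v"
proof -
  obtain \<pi> where \<pi>: "bij_betw \<pi> {1..CARD('p)} (UNIV :: 'p set)"
    "\<And>j. j \<in> {1..CARD('p)} \<Longrightarrow> sharp (u + v) j = \<bar>(u + v) $ \<pi> j\<bar>"
    by (rule sharp_sorting_bijection[of "u + v"]) blast
  have "sorted_l1 lam (u + v) = (\<Sum>j = 1..CARD('p). lam j * \<bar>(u + v) $ \<pi> j\<bar>)"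
    unfolding sorted_l1_def using \<pi>(2) by simp
  also have "\<dots> \<le> (\<Sum>j = 1..CARD('p). lam j * \<bar>u $ \<pi> j\<bar> + lam j * \<bar>v $ \<pi> j\<bar>)"
    using lam by (intro sum_mono)
      (auto simp: slope_weights_def distrib_left[symmetric] intro!: mult_left_mono abs_triangle_ineq)
  also have "\<dots> \<le> sorted_l1 lam u + sorted_l1 lam v"
    using rearrangement_le_sorted_l1[OF lam \<pi>(1), of u] rearrangement_le_sorted_l1[OF lam \<pi>(1), of v]
    by (simp add: sum.distrib)
  finally show ?thesis .
qed

lemma sorted_l1_scaleR_le:
  fixes u :: "real ^ 'p"
  assumes lam: "slope_weights CARD('p) lam" and "0 \<le> t"
  shows "sorted_l1 lam (t *\<^sub>R u) \<le> t * sorted_l1 lam u"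
proof -
  obtain \<pi> where \<pi>: "bij_betw \<pi> {1..CARD('p)} (UNIV :: 'p set)"
    "\<And>j. j \<in> {1..CARD('p)} \<Longrightarrow> sharp (t *\<^sub>R u) j = \<bar>(t *\<^sub>R u) $ \<pi> j\<bar>"
    by (rule sharp_sorting_bijection[of "t *\<^sub>R u"]) blast
  have "sorted_l1 lam (t *\<^sub>R u) = t * (\<Sum>j = 1..CARD('p). lam j * \<bar>u $ \<pi> j\<bar>)"
    unfolding sorted_l1_def using \<pi>(2) \<open>0 \<le> t\<close>
    by (simp add: sum_distrib_left abs_mult mult_ac)
  then show ?thesis
    using rearrangement_le_sorted_l1[OF lam \<pi>(1), of u] \<open>0 \<le> t\<close> by (simp add: mult_left_mono)
qed

text \<open>
  In the worst case the \<open>s\<close> largest entries of the perturbation \<open>u\<close> sit on the support of \<open>\<beta>\<close> and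
  cancel mass there, while the others add to the norm. To see this, \<open>\<beta> + u\<close> is bounded from below by the
  rearrangement inequality for an ordering \<open>\<phi>\<close> whose first \<open>s\<close> positions sort \<open>\<beta>\<close> and cover its
  support, where \<open>\<bar>\<beta> + u\<bar> \<ge> \<bar>\<beta>\<bar> - \<bar>u\<bar>\<close>, and which places at each later position \<open>j\<close> an entry of \<open>u\<close>
  of size at least \<open>sharp u j\<close>.
\<close>

lemma sparse_sorted_l1_diff_le:
  fixes \<beta> u :: "real ^ 'p"
  assumes lam: "slope_weights CARD('p) lam"
    and sp: "s \<le> CARD('p)" and sparse: "l0 \<beta> \<le> s"
  shows "sorted_l1 lam \<beta> - sorted_l1 lam (\<beta> + u)
      \<le> (\<Sum>j = 1..s. lam j * sharp u j) - (\<Sum>j = s+1..CARD('p). lam j * sharp u j)"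
proof -
  let ?p = "CARD('p)"
  obtain \<pi> where \<pi>: "bij_betw \<pi> {1..?p} (UNIV :: 'p set)"
    "\<And>j. j \<in> {1..?p} \<Longrightarrow> sharp \<beta> j = \<bar>\<beta> $ \<pi> j\<bar>"
    by (rule sharp_sorting_bijection[of \<beta>]) blast
  obtain \<psi> where \<psi>: "bij_betw \<psi> {1..?p} (UNIV :: 'p set)"
    "\<And>j. j \<in> {1..?p} \<Longrightarrow> sharp u j = \<bar>u $ \<psi> j\<bar>"
    by (rule sharp_sorting_bijection[of u]) blast
  define T where "T = \<pi> ` {1..s}"
  define R where "R = \<psi> ` {1..s}"
  have inj\<pi>: "inj_on \<pi> {1..?p}" and inj\<psi>: "inj_on \<psi> {1..?p}"
    using \<pi>(1) \<psi>(1) by (auto dest: bij_betw_imp_inj_on)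
  have inj\<pi>s: "inj_on \<pi> {1..s}" and inj\<psi>s: "inj_on \<psi> {1..s}"
    by (rule inj_on_subset[OF inj\<pi>], use sp in simp, rule inj_on_subset[OF inj\<psi>], use sp in simp)
  have card_T: "card T = s" and card_R: "card R = s"
    using card_image[OF inj\<pi>s] card_image[OF inj\<psi>s] by (simp_all add: T_def R_def)
  \<comment> \<open>A nonzero entry of \<open>\<beta>\<close> at a position \<open>j > s\<close> would force nonzero entries at all
    earlier positions, hence more than \<open>s\<close> of them.\<close>
  have tail0: "sharp \<beta> j = 0" if j: "j \<in> {s+1..?p}" for j
  proof (rule ccontr)
    assume "sharp \<beta> j \<noteq> 0"
    then have pos: "0 < sharp \<beta> j" using sharp_nonneg[of j \<beta>] j by simp
    have "\<pi> ` {1..j} \<subseteq> {i. \<beta> $ i \<noteq> 0}"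
    proof
      fix x assume "x \<in> \<pi> ` {1..j}"
      then obtain i where i: "i \<in> {1..j}" "x = \<pi> i" by auto
      have "sharp \<beta> j \<le> sharp \<beta> i" using i j by (intro sharp_antimono) auto
      then have "0 < \<bar>\<beta> $ x\<bar>" using pos \<pi>(2)[of i] i j by simp
      then show "x \<in> {i. \<beta> $ i \<noteq> 0}" by simp
    qed
    then have "card (\<pi> ` {1..j}) \<le> l0 \<beta>" unfolding l0_def by (intro card_mono) auto
    moreover have "inj_on \<pi> {1..j}" by (rule inj_on_subset[OF inj\<pi>]) (use j in simp)
    ultimately show False using sparse j by (simp add: card_image)
  qed
  have off: "\<beta> $ i = 0" if "i \<notin> T" for i
  proof -
    obtain j where "j \<in> {1..?p}" "i = \<pi> j"
      using bij_betw_imp_surj_on[OF \<pi>(1)] by (metis UNIV_I imageE)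
    then show ?thesis using that tail0[of j] \<pi>(2)[of j] by (cases "j \<le> s") (auto simp: T_def)
  qed
  \<comment> \<open>Tail positions whose entry of \<open>u\<close> was already used by \<open>T\<close> receive one of the leftover
    large entries instead, so the tail stays above \<open>sharp u\<close>.\<close>
  define J where "J = {j \<in> {s+1..?p}. \<psi> j \<in> T}"
  have "{s+1..?p} = {1..?p} - {1..s}" by auto
  moreover have "\<psi> ` ({1..?p} - {1..s}) = \<psi> ` {1..?p} - \<psi> ` {1..s}"
    by (rule inj_on_image_set_diff[OF inj\<psi>]) (use sp in auto)
  ultimately have tail_im: "\<psi> ` {s+1..?p} = - R"
    using bij_betw_imp_surj_on[OF \<psi>(1)] by (simp only: R_def Compl_eq_Diff_UNIV)
  have "\<psi> ` J = \<psi> ` {s+1..?p} \<inter> T" unfolding J_def by blast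
  then have J_im: "\<psi> ` J = T - R" unfolding tail_im by blast
  have "inj_on \<psi> J" using inj\<psi> by (rule inj_on_subset) (auto simp: J_def)
  then have "card J = card (T - R)" using card_image[of \<psi> J] J_im by simp
  also have "\<dots> = card (R - T)"
    using card_T card_R card_Diff_subset_Int[of T R] card_Diff_subset_Int[of R T]
    by (simp add: Int_commute)
  finally obtain g where g: "bij_betw g J (R - T)"
    using finite_same_card_bij[of J "R - T"] by (auto simp: J_def)
  \<comment> \<open>The sets \<open>T\<close>, \<open>R - T\<close> and the complement of \<open>R \<union> T\<close> partition the indices, and \<open>\<phi>\<close> maps
    the three corresponding blocks of positions onto them.\<close>
  define \<phi> where "\<phi> j = (if j \<le> s then \<pi> j else if j \<in> J then g j else \<psi> j)" for j
  have "bij_betw \<pi> {1..s} T" using inj\<pi>s by (simp add: bij_betw_def T_def)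
  then have b1: "bij_betw \<phi> {1..s} T" by (rule bij_betw_cong[THEN iffD1, rotated]) (simp add: \<phi>_def)
  have b2: "bij_betw \<phi> J (R - T)"
    using g by (rule bij_betw_cong[THEN iffD1, rotated]) (auto simp: \<phi>_def J_def)
  have "\<psi> ` ({s+1..?p} - J) = \<psi> ` {s+1..?p} - T" unfolding J_def by blast
  then have im3: "\<psi> ` ({s+1..?p} - J) = - (R \<union> T)" unfolding tail_im by blast
  have "inj_on \<psi> ({s+1..?p} - J)" using inj\<psi> by (rule inj_on_subset) auto
  then have "bij_betw \<psi> ({s+1..?p} - J) (- (R \<union> T))" using im3 by (simp add: bij_betw_def)
  then have b3: "bij_betw \<phi> ({s+1..?p} - J) (- (R \<union> T))"
    by (rule bij_betw_cong[THEN iffD1, rotated]) (auto simp: \<phi>_def)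
  have b4: "bij_betw \<phi> ({1..s} \<union> J \<union> ({s+1..?p} - J)) (T \<union> (R - T) \<union> - (R \<union> T))"
    by (intro bij_betw_combine b1 b2 b3) auto
  have "{1..s} \<union> J \<union> ({s+1..?p} - J) = {1..?p}" using sp by (auto simp: J_def)
  moreover have "T \<union> (R - T) \<union> - (R \<union> T) = UNIV" by auto
  ultimately have bij: "bij_betw \<phi> {1..?p} UNIV" using b4 by simp

  have lam0: "0 \<le> lam j" if "j \<in> {1..?p}" for j using lam that by (simp add: slope_weights_def)
  have split: "(\<Sum>j = 1..?p. h j) = (\<Sum>j = 1..s. h j) + (\<Sum>j = s+1..?p. h j)" for h :: "nat \<Rightarrow> real"
    using sum.ub_add_nat[of 1 s h "?p - s"] sp by simp
  have tail: "sharp u j \<le> \<bar>(\<beta> + u) $ \<phi> j\<bar>" if j: "j \<in> {s+1..?p}" for j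
  proof (cases "j \<in> J")
    case True
    then have gj: "g j \<in> R - T" using g by (auto simp: bij_betw_def)
    then obtain i where i: "i \<in> {1..s}" "g j = \<psi> i" by (auto simp: R_def)
    have "sharp u j \<le> sharp u i" using i j by (intro sharp_antimono) auto
    then show ?thesis using i j True gj off[of "g j"] \<psi>(2)[of i] by (simp add: \<phi>_def)
  next
    case False
    then show ?thesis using j off[of "\<psi> j"] \<psi>(2)[of j] by (auto simp: \<phi>_def J_def)
  qed
  have "(\<Sum>j = 1..s. lam j * (\<bar>\<beta> $ \<pi> j\<bar> - \<bar>u $ \<pi> j\<bar>)) + (\<Sum>j = s+1..?p. lam j * sharp u j)
      \<le> (\<Sum>j = 1..s. lam j * \<bar>(\<beta> + u) $ \<phi> j\<bar>) + (\<Sum>j = s+1..?p. lam j * \<bar>(\<beta> + u) $ \<phi> j\<bar>)"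
    using sp by (intro add_mono sum_mono mult_left_mono lam0 tail) (auto simp: \<phi>_def)
  also have "\<dots> \<le> sorted_l1 lam (\<beta> + u)"
    using rearrangement_le_sorted_l1[OF lam bij, of "\<beta> + u"] by (simp only: split)
  finally have low: "(\<Sum>j = 1..s. lam j * \<bar>\<beta> $ \<pi> j\<bar>) - (\<Sum>j = 1..s. lam j * \<bar>u $ \<pi> j\<bar>)
      + (\<Sum>j = s+1..?p. lam j * sharp u j) \<le> sorted_l1 lam (\<beta> + u)"
    by (simp add: right_diff_distrib sum_subtractf)
  have "sorted_l1 lam \<beta> = (\<Sum>j = 1..s. lam j * \<bar>\<beta> $ \<pi> j\<bar>)"
    unfolding sorted_l1_def split using tail0 \<pi>(2) sp by simp
  moreover have "(\<Sum>j = 1..s. lam j * \<bar>u $ \<pi> j\<bar>) \<le> (\<Sum>j = 1..s. lam j * sharp u j)"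
  proof -
    \<comment> \<open>Truncated weights are still non-increasing, and their sorted l1 norm is the head.\<close>
    let ?l = "\<lambda>j. if j \<le> s then lam j else 0"
    have "slope_weights ?p ?l" using lam by (auto simp: slope_weights_def)
    from rearrangement_le_sorted_l1[OF this \<pi>(1), of u]
    show ?thesis unfolding sorted_l1_def split by simp
  qed
  ultimately show ?thesis using low by linarith
qed

lemma sharp_head_le:
  fixes u :: "real ^ 'p"
  assumes "s \<le> CARD('p)"
  shows "(\<Sum>j = 1..s. lam j * sharp u j) \<le> norm u * sqrt (\<Sum>j = 1..s. (lam j)\<^sup>2)"
proof -
  have "(\<Sum>j = 1..s. lam j * sharp u j)
      \<le> sqrt (\<Sum>j = 1..s. (lam j)\<^sup>2) * sqrt (\<Sum>j = 1..s. (sharp u j)\<^sup>2)"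
    using L2_set_mult_ineq[of lam "sharp u" "{1..s}"]
      sum_mono[of "{1..s}" "\<lambda>j. lam j * sharp u j" "\<lambda>j. \<bar>lam j\<bar> * \<bar>sharp u j\<bar>"]
    by (force simp: L2_set_def abs_mult[symmetric])
  also have "\<dots> \<le> sqrt (\<Sum>j = 1..s. (lam j)\<^sup>2) * sqrt (\<Sum>j = 1..CARD('p). (sharp u j)\<^sup>2)"
    using assms by (intro mult_left_mono real_sqrt_le_mono sum_mono2) (auto intro: sum_nonneg)
  finally show ?thesis
    by (simp only: sum_sharp_squares real_sqrt_abs abs_norm_cancel mult.commute)
qed

section \<open>The Slope estimator\<close>

lemma emp_norm_sq:
  fixes u :: "real ^ 'n"
  shows "(emp_norm u)\<^sup>2 = (u \<bullet> u) / real CARD('n)"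
  by (simp add: emp_norm_def inner_vec_def power2_eq_square sum_nonneg)

lemma emp_norm_nonneg: "0 \<le> emp_norm u"
  by (simp add: emp_norm_def sum_nonneg)

text \<open>
  Merely comparing the objective at \<open>b\<close> and at \<open>\<beta>\<close> would lose the term \<open>(emp_norm (X *v (b - \<beta>)))\<^sup>2\<close>
  on the left. It is retained by moving from \<open>b\<close> only a fraction \<open>t\<close> of the way to \<open>\<beta>\<close>: the penalty
  is convex, and the quadratic term is of second order in \<open>t\<close>.
\<close>

lemma slope_basic_inequality:
  fixes X :: "real ^ 'p ^ 'n"
  assumes lam: "slope_weights CARD('p) lam"
    and slope: "is_slope_estimator lam X (f + e) b"
  shows "(emp_norm (X *v b - f))\<^sup>2 + (emp_norm (X *v (b - \<beta>)))\<^sup>2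
      \<le> (emp_norm (X *v \<beta> - f))\<^sup>2
        + 2 * ((1 / real CARD('n)) * (e \<bullet> (X *v (b - \<beta>))) + sorted_l1 lam \<beta> - sorted_l1 lam b)"
proof -
  let ?n = "real CARD('n)"
  define v where "v = X *v (b - \<beta>)"
  define r where "r = X *v b - f"
  define P where "P = sorted_l1 lam \<beta> - sorted_l1 lam b"
  have \<beta>_res: "X *v \<beta> - f = r - v"
    by (simp add: r_def v_def matrix_vector_mult_diff_distrib)
  have step: "2 * ((v \<bullet> (r - e)) / ?n) \<le> t * ((v \<bullet> v) / ?n) + 2 * P" if t: "0 < t" "t < 1" for t
  proof -
    have "sorted_l1 lam (b - t *\<^sub>R (b - \<beta>)) = sorted_l1 lam ((1 - t) *\<^sub>R b + t *\<^sub>R \<beta>)"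
      by (simp add: algebra_simps)
    also have "\<dots> \<le> (1 - t) * sorted_l1 lam b + t * sorted_l1 lam \<beta>"
      using sorted_l1_triangle[OF lam, of "(1 - t) *\<^sub>R b" "t *\<^sub>R \<beta>"]
        sorted_l1_scaleR_le[OF lam, of "1 - t" b] sorted_l1_scaleR_le[OF lam, of t \<beta>] t by simp
    finally have pen: "sorted_l1 lam (b - t *\<^sub>R (b - \<beta>)) \<le> sorted_l1 lam b + t * P"
      by (simp add: P_def algebra_simps)
    have res: "X *v (b - t *\<^sub>R (b - \<beta>)) - (f + e) = (r - e) - t *\<^sub>R v"
      by (simp add: r_def v_def matrix_vector_mult_diff_distrib matrix_vector_mult_scaleR algebra_simps)
    have "(emp_norm (X *v b - (f + e)))\<^sup>2 + 2 * sorted_l1 lam b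
        \<le> (emp_norm (X *v (b - t *\<^sub>R (b - \<beta>)) - (f + e)))\<^sup>2 + 2 * sorted_l1 lam (b - t *\<^sub>R (b - \<beta>))"
      using slope by (auto simp: is_slope_estimator_def is_arg_min_def not_less)
    moreover have "X *v b - (f + e) = r - e" by (simp add: r_def)
    ultimately have "((r - e) \<bullet> (r - e)) / ?n
        \<le> (((r - e) - t *\<^sub>R v) \<bullet> ((r - e) - t *\<^sub>R v)) / ?n + 2 * (t * P)"
      using pen unfolding res emp_norm_sq by simp
    also have "((r - e) - t *\<^sub>R v) \<bullet> ((r - e) - t *\<^sub>R v)
        = (r - e) \<bullet> (r - e) - 2 * t * (v \<bullet> (r - e)) + t * (t * (v \<bullet> v))"
      by (simp add: inner_diff_left inner_diff_right inner_commute algebra_simps)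
    finally have "t * (2 * ((v \<bullet> (r - e)) / ?n)) \<le> t * (t * ((v \<bullet> v) / ?n) + 2 * P)"
      by (simp add: add_divide_distrib diff_divide_distrib algebra_simps)
    then show ?thesis by (simp only: mult_le_cancel_left_pos[OF t(1)])
  qed
  \<comment> \<open>Letting \<open>t\<close> tend to 0 removes the quadratic term.\<close>
  have "2 * ((v \<bullet> (r - e)) / ?n) \<le> 2 * P"
  proof (rule tendsto_lowerbound)
    show "((\<lambda>t. t * ((v \<bullet> v) / ?n) + 2 * P) \<longlongrightarrow> 2 * P) (at_right 0)"
      by (auto intro!: tendsto_eq_intros)
    show "\<forall>\<^sub>F t in at_right 0. 2 * ((v \<bullet> (r - e)) / ?n) \<le> t * ((v \<bullet> v) / ?n) + 2 * P"
      using eventually_at_right_real[of 0 1] by (rule eventually_mono) (use step in auto)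
  qed simp
  moreover have "(emp_norm (X *v \<beta> - f))\<^sup>2 = (r \<bullet> r - 2 * (v \<bullet> r) + v \<bullet> v) / ?n"
    unfolding \<beta>_res emp_norm_sq by (simp add: inner_diff_left inner_diff_right inner_commute)
  ultimately show ?thesis
    unfolding emp_norm_sq v_def[symmetric] r_def[symmetric]
    by (simp add: P_def inner_diff_right inner_commute add_divide_distrib diff_divide_distrib)
qed

lemma vartheta_le:
  fixes X :: "real ^ 'p ^ 'n"
  assumes "\<delta> \<in> cone_WRE lam s c0"
  shows "vartheta X lam s c0 * norm \<delta> \<le> emp_norm (X *v \<delta>)"
proof (cases "\<delta> = 0")
  case True
  then show ?thesis by (simp add: emp_norm_nonneg)
next
  case False
  have "bdd_below ((\<lambda>\<delta>. emp_norm (X *v \<delta>) / norm \<delta>) ` (cone_WRE lam s c0 - {0}))"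
    by (rule bdd_belowI[where m = 0]) (auto simp: emp_norm_nonneg)
  then have "vartheta X lam s c0 \<le> emp_norm (X *v \<delta>) / norm \<delta>"
    unfolding vartheta_def using assms False by (intro cINF_lower) auto
  then show ?thesis using False by (simp add: field_simps)
qed

section \<open>Prediction and estimation bounds\<close>

text \<open>
  The bound on \<open>D\<close> involves \<open>emp_norm (X *v u)\<close> when the noise is dominated by the prediction error,
  and \<open>norm u\<close> when it is dominated by the penalty; in the latter case \<open>u\<close> satisfies the cone
  constraint, so that \<open>norm u\<close> is in turn controlled by \<open>emp_norm (X *v u)\<close>. The constant
  \<open>c0_const \<gamma> \<tau>\<close> is the ratio of the coefficients of the head and the tail of the sorted l1 norm in
  the bound for \<open>D\<close>.
\<close>

lemma noise_dichotomy:
  fixes X :: "real ^ 'p ^ 'n" and b \<beta> :: "real ^ 'p"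
  defines "u \<equiv> b - \<beta>"
  assumes lam: "slope_weights CARD('p) lam"
    and sp: "s \<le> CARD('p)" and sparse: "l0 \<beta> \<le> s"
    and \<gamma>: "0 \<le> \<gamma>" and \<tau>: "0 \<le> \<tau>" "\<gamma> + \<tau> < 1"
    and N: "N \<le> \<gamma> * max (sorted_l1 lam u) (B * emp_norm (X *v u))"
    and D: "D = N + \<tau> * sorted_l1 lam u + sorted_l1 lam \<beta> - sorted_l1 lam b"
    and D0: "0 \<le> D"
  shows "sorted_l1 lam u \<le> B * emp_norm (X *v u) \<and> D \<le> (1 + \<gamma> + \<tau>) * (B * emp_norm (X *v u))
    \<or> u \<in> cone_WRE lam s (c0_const \<gamma> \<tau>)
      \<and> D \<le> (1 + \<gamma> + \<tau>) * (norm u * sqrt (\<Sum>j = 1..s. (lam j)\<^sup>2))"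
proof (cases "sorted_l1 lam u \<le> B * emp_norm (X *v u)")
  case True
  have b: "b = \<beta> + u" by (simp add: u_def)
  have "sorted_l1 lam \<beta> - sorted_l1 lam b \<le> sorted_l1 lam (- u)"
    using sorted_l1_triangle[OF lam, of "\<beta> + u" "- u"] by (simp add: b)
  also have "sorted_l1 lam (- u) = sorted_l1 lam u"
    by (simp add: sorted_l1_def sharp_def)
  finally have "D \<le> \<gamma> * (B * emp_norm (X *v u)) + (1 + \<tau>) * sorted_l1 lam u"
    using N True by (simp add: D algebra_simps max_absorb2)
  also have "(1 + \<tau>) * sorted_l1 lam u \<le> (1 + \<tau>) * (B * emp_norm (X *v u))"
    using True \<tau> by (intro mult_left_mono) auto
  finally show ?thesis using True by (simp add: algebra_simps)
next
  case False
  define hd where "hd = (\<Sum>j = 1..s. lam j * sharp u j)"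
  define tl where "tl = (\<Sum>j = s+1..CARD('p). lam j * sharp u j)"
  define L where "L = norm u * sqrt (\<Sum>j = 1..s. (lam j)\<^sup>2)"
  have tot: "sorted_l1 lam u = hd + tl"
    using sum.ub_add_nat[of 1 s "\<lambda>j. lam j * sharp u j" "CARD('p) - s"] sp
    by (simp add: sorted_l1_def hd_def tl_def)
  have tl0: "0 \<le> tl" unfolding tl_def
    using lam by (intro sum_nonneg mult_nonneg_nonneg sharp_nonneg) (auto simp: slope_weights_def)
  have b: "b = \<beta> + u" by (simp add: u_def)
  have "sorted_l1 lam \<beta> - sorted_l1 lam b \<le> hd - tl"
    unfolding b hd_def tl_def by (rule sparse_sorted_l1_diff_le[OF lam sp sparse])
  then have D1: "D \<le> (1 + \<gamma> + \<tau>) * hd - (1 - \<gamma> - \<tau>) * tl"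
    using N False by (simp add: D tot algebra_simps max_absorb1)
  have hL: "hd \<le> L" unfolding hd_def L_def by (rule sharp_head_le[OF sp])
  then have hL': "(1 + \<gamma> + \<tau>) * hd \<le> (1 + \<gamma> + \<tau>) * L" using \<gamma> \<tau> by (intro mult_left_mono) auto
  have "(1 - \<gamma> - \<tau>) * tl \<le> (1 + \<gamma> + \<tau>) * L" using D1 D0 hL' by linarith
  then have "tl \<le> c0_const \<gamma> \<tau> * L" using \<tau> by (simp add: c0_const_def field_simps)
  then have "sorted_l1 lam u \<le> (1 + c0_const \<gamma> \<tau>) * L" using hL by (simp add: tot distrib_right)
  then have "u \<in> cone_WRE lam s (c0_const \<gamma> \<tau>)" by (simp add: cone_WRE_def L_def mult.assoc)
  moreover have "0 \<le> (1 - \<gamma> - \<tau>) * tl" using tl0 \<tau> by (intro mult_nonneg_nonneg) auto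
  then have "D \<le> (1 + \<gamma> + \<tau>) * L" using D1 hL' by linarith
  ultimately show ?thesis by (simp add: L_def)
qed

lemma two_mult_minus_square_le: "2 * (a * w) - w\<^sup>2 \<le> a\<^sup>2" for a w :: real
  using zero_le_power2[of "a - w"] by (simp add: power2_diff)

lemma prediction_excess_le:
  fixes X :: "real ^ 'p ^ 'n" and b \<beta> :: "real ^ 'p"
  defines "u \<equiv> b - \<beta>"
  assumes lam: "slope_weights CARD('p) lam"
    and sp: "s \<le> CARD('p)" and sparse: "l0 \<beta> \<le> s"
    and \<gamma>: "0 \<le> \<gamma>" and \<tau>: "0 \<le> \<tau>" "\<gamma> + \<tau> < 1"
    and N: "N \<le> \<gamma> * max (sorted_l1 lam u) (B * emp_norm (X *v u))"
    and D: "D = N + \<tau> * sorted_l1 lam u + sorted_l1 lam \<beta> - sorted_l1 lam b"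
    and BK: "B\<^sup>2 \<le> K * (\<Sum>j = 1..s. (lam j)\<^sup>2)" 
    and \<theta>: "vartheta X lam s (c0_const \<gamma> \<tau>) > 0"
  shows "2 * D - (emp_norm (X *v u))\<^sup>2
    \<le> (1 + \<gamma> + \<tau>)\<^sup>2 * max K (1 / (vartheta X lam s (c0_const \<gamma> \<tau>))\<^sup>2) * (\<Sum>j = 1..s. (lam j)\<^sup>2)"
proof -
  define c where "c = 1 + \<gamma> + \<tau>"
  define th where "th = vartheta X lam s (c0_const \<gamma> \<tau>)"
  define S where "S = (\<Sum>j = 1..s. (lam j)\<^sup>2)"
  define w where "w = emp_norm (X *v u)"
  have c: "0 \<le> c" using \<gamma> \<tau> by (simp add: c_def)
  have th: "0 < th" using \<theta> by (simp add: th_def)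
  have S: "0 \<le> S" by (simp add: S_def sum_nonneg)
  have w: "0 \<le> w" by (simp add: w_def emp_norm_nonneg)
  have mono: "c\<^sup>2 * (k * S) \<le> c\<^sup>2 * max K (1 / th\<^sup>2) * S" if "k \<le> max K (1 / th\<^sup>2)" for k
    using that S by (simp add: mult.assoc mult_left_mono mult_right_mono)
  have "2 * D - w\<^sup>2 \<le> c\<^sup>2 * max K (1 / th\<^sup>2) * S"
  proof (cases "0 \<le> D")
    case False
    have "0 \<le> max K (1 / th\<^sup>2)" by (simp add: le_max_iff_disj)
    then have "0 \<le> c\<^sup>2 * max K (1 / th\<^sup>2) * S" using S by simp
    moreover have "0 \<le> w\<^sup>2" by simp
    ultimately show ?thesis using False by linarith
  next
    case True
    have "sorted_l1 lam u \<le> B * w \<and> D \<le> c * (B * w)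
      \<or> u \<in> cone_WRE lam s (c0_const \<gamma> \<tau>) \<and> D \<le> c * (norm u * sqrt S)"
      using noise_dichotomy[OF lam sp sparse \<gamma> \<tau> N[unfolded u_def] D[unfolded u_def] True]
      unfolding c_def S_def w_def u_def .
    then show ?thesis
    proof (elim disjE conjE)
      assume "sorted_l1 lam u \<le> B * w" "D \<le> c * (B * w)"
      then have "2 * D - w\<^sup>2 \<le> (c * B)\<^sup>2"
        using two_mult_minus_square_le[of "c * B" w] by (simp add: mult.assoc)
      also have "\<dots> \<le> c\<^sup>2 * (K * S)" using BK by (simp add: power_mult_distrib mult_left_mono S_def)
      also have "\<dots> \<le> c\<^sup>2 * max K (1 / th\<^sup>2) * S" by (rule mono) simp
      finally show ?thesis .
    next
      assume cone: "u \<in> cone_WRE lam s (c0_const \<gamma> \<tau>)" and DS: "D \<le> c * (norm u * sqrt S)"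
      have "norm u \<le> w / th"
        using vartheta_le[OF cone, of X] th by (simp add: th_def w_def field_simps)
      then have "c * (norm u * sqrt S) \<le> c * (w / th * sqrt S)"
        using c S by (intro mult_left_mono mult_right_mono) auto
      from order_trans[OF DS this] have "D \<le> c * sqrt S / th * w" by (simp add: mult_ac)
      then have "2 * D - w\<^sup>2 \<le> (c * sqrt S / th)\<^sup>2"
        using two_mult_minus_square_le[of "c * sqrt S / th" w] by linarith
      also have "\<dots> = c\<^sup>2 * (1 / th\<^sup>2 * S)" using S by (simp add: power_mult_distrib power_divide)
      also have "\<dots> \<le> c\<^sup>2 * max K (1 / th\<^sup>2) * S" by (rule mono) simp
      finally show ?thesis .
    qed
  qed
  then show ?thesis by (simp add: c_def th_def S_def w_def)
qed

text \<open>
  Membership in the cone gives \<open>norm u \<le> w / vartheta\<close>, with \<open>w = emp_norm (X *v u)\<close>. Outside the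
  cone, the sorted l1 norm of \<open>u\<close> exceeds \<open>norm u * sqrt (\<Sum>j = 1..s. (lam j)\<^sup>2)\<close>, so an upper bound
  on the sorted l1 norm bounds \<open>norm u\<close> directly. The second situation occurs only in the first case
  of the dichotomy, which provides the bound \<open>B * w\<close>.
\<close>

lemma estimation_error_le:
  fixes X :: "real ^ 'p ^ 'n" and b \<beta> :: "real ^ 'p"
  defines "u \<equiv> b - \<beta>"
  assumes lam: "slope_weights CARD('p) lam"
    and sp: "s \<le> CARD('p)" and sparse: "l0 \<beta> \<le> s"
    and \<gamma>: "0 \<le> \<gamma>" "\<gamma> < 1"
    and N: "N \<le> \<gamma> * max (sorted_l1 lam u) (B * emp_norm (X *v u))"
    and basic: "(emp_norm (X *v u))\<^sup>2 \<le> N + sorted_l1 lam \<beta> - sorted_l1 lam b"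
    and B: "0 \<le> B" and BK: "B\<^sup>2 \<le> K * (\<Sum>j = 1..s. (lam j)\<^sup>2)"
    and Spos: "0 < (\<Sum>j = 1..s. (lam j)\<^sup>2)"
    and \<theta>: "vartheta X lam s (c0_const \<gamma> 0) > 0"
  shows "norm u \<le> (1 + \<gamma>) * max K (1 / (vartheta X lam s (c0_const \<gamma> 0))\<^sup>2)
      * sqrt (\<Sum>j = 1..s. (lam j)\<^sup>2)"
proof -
  define th where "th = vartheta X lam s (c0_const \<gamma> 0)"
  define R where "R = sqrt (\<Sum>j = 1..s. (lam j)\<^sup>2)"
  define w where "w = emp_norm (X *v u)"
  define D where "D = N + 0 * sorted_l1 lam u + sorted_l1 lam \<beta> - sorted_l1 lam b"
  have th: "0 < th" using \<theta> by (simp add: th_def)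
  have R: "0 < R" using Spos by (simp add: R_def)
  have R2: "(\<Sum>j = 1..s. (lam j)\<^sup>2) = R\<^sup>2" using Spos by (simp add: R_def)
  have w: "0 \<le> w" by (simp add: w_def emp_norm_nonneg)
  have wD: "w\<^sup>2 \<le> D" using basic by (simp add: D_def w_def)
  then have D0: "0 \<le> D" using order_trans[OF zero_le_power2] by blast
  have BR: "(B / R)\<^sup>2 \<le> K" using BK[unfolded R2] R by (simp add: power_divide field_simps)
  have cancel: "w \<le> a" if "w\<^sup>2 \<le> a * w" "0 \<le> a" for a
    using that w by (cases "w = 0") (auto simp: power2_eq_square)
  have mono: "(1 + \<gamma>) * k * R \<le> (1 + \<gamma>) * max K (1 / th\<^sup>2) * R" if "k \<le> max K (1 / th\<^sup>2)" for k
    using that \<gamma> R by (intro mult_right_mono mult_left_mono) auto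
  have cone_le: "norm u \<le> w / th" if "u \<in> cone_WRE lam s (c0_const \<gamma> 0)"
    using vartheta_le[OF that, of X] th by (simp add: th_def w_def field_simps)
  have "\<gamma> + 0 < 1" using \<gamma> by simp
  then have "sorted_l1 lam u \<le> B * w \<and> D \<le> (1 + \<gamma>) * (B * w)
      \<or> u \<in> cone_WRE lam s (c0_const \<gamma> 0) \<and> D \<le> (1 + \<gamma>) * (norm u * R)"
    using noise_dichotomy[OF lam sp sparse \<gamma>(1) order_refl _ N[unfolded u_def] D_def[unfolded u_def] D0]
    unfolding w_def R_def u_def add_0_right by blast
  then have "norm u \<le> (1 + \<gamma>) * max K (1 / th\<^sup>2) * R"
  proof (elim disjE conjE)
    assume star: "sorted_l1 lam u \<le> B * w" and "D \<le> (1 + \<gamma>) * (B * w)"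
    with wD have "w\<^sup>2 \<le> ((1 + \<gamma>) * B) * w" by (simp add: mult.assoc)
    then have wB: "w \<le> (1 + \<gamma>) * B" using \<gamma> B by (intro cancel) auto
    show ?thesis
    proof (cases "u \<in> cone_WRE lam s (c0_const \<gamma> 0)")
      case True
      have "norm u \<le> (1 + \<gamma>) * B / th"
        using cone_le[OF True] wB th by (simp add: field_simps)
      also have "\<dots> = (1 + \<gamma>) * ((B / R) * (1 / th)) * R" using R by simp
      also have "\<dots> \<le> (1 + \<gamma>) * max K (1 / th\<^sup>2) * R"
      proof (rule mono)
        \<comment> \<open>A product of two numbers is at most the larger of their squares.\<close>
        have "(B / R) * (1 / th) \<le> max ((B / R)\<^sup>2) ((1 / th)\<^sup>2)"
          using two_mult_minus_square_le[of "B / R" "1 / th"]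
          by (simp add: max_def split: if_splits)
        also have "\<dots> \<le> max K (1 / th\<^sup>2)" using BR by (simp add: power_divide max.coboundedI1)
        finally show "(B / R) * (1 / th) \<le> max K (1 / th\<^sup>2)" .
      qed
      finally show ?thesis .
    next
      case False
      then have "(1 + c0_const \<gamma> 0) * (norm u * R) < sorted_l1 lam u"
        by (simp add: cone_WRE_def R_def mult.assoc)
      moreover have "norm u * R \<le> (1 + c0_const \<gamma> 0) * (norm u * R)"
        using mult_nonneg_nonneg[of "c0_const \<gamma> 0" "norm u * R"] \<gamma> R
        by (simp add: c0_const_def distrib_right)
      moreover have "B * w \<le> B * ((1 + \<gamma>) * B)" using wB B by (rule mult_left_mono)
      ultimately have "norm u * R \<le> (1 + \<gamma>) * B\<^sup>2"
        using star by (simp add: power2_eq_square mult_ac)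
      then have "norm u * R / R \<le> (1 + \<gamma>) * B\<^sup>2 / R" using R by (intro divide_right_mono) auto
      then have "norm u \<le> (1 + \<gamma>) * (B / R)\<^sup>2 * R"
        using R by (simp add: power2_eq_square)
      also have "\<dots> \<le> (1 + \<gamma>) * max K (1 / th\<^sup>2) * R"
        by (rule mono) (use BR in auto)
      finally show ?thesis .
    qed
  next
    assume cone: "u \<in> cone_WRE lam s (c0_const \<gamma> 0)" and DR: "D \<le> (1 + \<gamma>) * (norm u * R)"
    have "(1 + \<gamma>) * (norm u * R) \<le> (1 + \<gamma>) * (w / th * R)"
      using cone_le[OF cone] \<gamma> R by (intro mult_left_mono mult_right_mono) auto
    with wD DR have "w\<^sup>2 \<le> ((1 + \<gamma>) * R / th) * w" by (simp add: mult_ac)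
    then have "w \<le> (1 + \<gamma>) * R / th" using \<gamma> R th by (intro cancel) auto
    then have "w / th \<le> (1 + \<gamma>) * R / th / th" using th by (intro divide_right_mono) auto
    with cone_le[OF cone] have "norm u \<le> (1 + \<gamma>) * (1 / th\<^sup>2) * R"
      by (simp add: power2_eq_square mult_ac)
    also have "\<dots> \<le> (1 + \<gamma>) * max K (1 / th\<^sup>2) * R" by (rule mono) simp
    finally show ?thesis .
  qed
  then show ?thesis by (simp add: th_def R_def)
qed

section \<open>Bounds for the logarithmic weights\<close>

theorem theorem6p1:
  fixes X :: "real ^ 'p ^ 'n"
    and M :: "'w measure"
    and \<xi> :: "'w \<Rightarrow> real ^ 'n"
    and \<sigma> \<gamma> \<tau> A \<delta>0 :: real
    and lam :: "nat \<Rightarrow> real"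
    and Omega :: "'w set"
  assumes "\<sigma> > 0"
    and "\<forall>j. emp_norm (X *v axis j 1) \<le> 1"
    and "prob_space M"
    and "gaussian_noise M \<sigma> \<xi>"
    and "0 < \<gamma>" and "\<gamma> < 1"
    and "0 \<le> \<tau>" and "\<tau> < 1 - \<gamma>"
    and "A \<ge> (4 + sqrt 2) / \<gamma>"
    and "\<forall>j\<in>{1..CARD('p)}. lam j = A * \<sigma> * sqrt (ln (2 * real CARD('p) / real j) / real CARD('n))"
    and "0 < \<delta>0" and "\<delta>0 < 1"
    and "Omega = {\<omega> \<in> space M. \<forall>u :: real ^ 'p.
           (1 / real CARD('n)) * (\<xi> \<omega> \<bullet> (X *v u)) \<le> max (H_fun \<sigma> X u) (G_fun \<sigma> \<delta>0 X u)}"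
  shows "(\<forall>\<omega>\<in>Omega. \<forall>(f :: real ^ 'n) (bhat :: real ^ 'p) (s :: nat) (\<beta> :: real ^ 'p).
            is_slope_estimator lam X (f + \<xi> \<omega>) bhat \<longrightarrow> s \<in> {1..CARD('p)} \<longrightarrow> l0 \<beta> = s \<longrightarrow>
              ereal (2 * \<tau> * sorted_l1 lam (bhat - \<beta>) + (emp_norm (X *v bhat - f))\<^sup>2)
                \<le> ereal ((emp_norm (X *v \<beta> - f))\<^sup>2)
                   + C_const X lam \<gamma> \<tau> s \<delta>0 * ereal (\<Sum>j = 1..s. (lam j)\<^sup>2))
       \<and> (\<forall>s\<in>{1..CARD('p)}. \<forall>(f :: real ^ 'n) (\<beta>s :: real ^ 'p).
            f = X *v \<beta>s \<longrightarrow> l0 \<beta>s \<le> s \<longrightarrow>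
            (\<forall>\<omega>\<in>Omega. \<forall>bhat :: real ^ 'p. is_slope_estimator lam X (f + \<xi> \<omega>) bhat \<longrightarrow>
              ereal (2 * \<tau> * sorted_l1 lam (bhat - \<beta>s))
                \<le> C_const X lam \<gamma> \<tau> s \<delta>0 * ereal (\<Sum>j = 1..s. (lam j)\<^sup>2)
              \<and> ereal (norm (bhat - \<beta>s))
                \<le> C_const X lam \<gamma> 0 s \<delta>0 / ereal (1 + \<gamma>) * ereal (sqrt (\<Sum>j = 1..s. (lam j)\<^sup>2))))"
proof -
  let ?n = "real CARD('n)" and ?p = "CARD('p)"
  note \<sigma> = assms(1) and \<gamma> = assms(5,6) and \<tau> = assms(7,8) and A = assms(9)
    and lam_eq = assms(10) and \<delta> = assms(11,12) and Om = assms(13)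
  define B where "B = A * \<sigma> * sqrt (ln (1 / \<delta>0) / ?n)"
  define K where "K s = ln (1 / \<delta>0) / (real s * ln (2 * real ?p / real s))" for s
  define S where "S s = (\<Sum>j = 1..s. (lam j)\<^sup>2)" for s
  have "0 < (4 + sqrt 2) / \<gamma>" using \<gamma> by (intro divide_pos_pos add_pos_nonneg) auto
  then have A0: "0 < A" using A by linarith
  have \<kappa>: "4 + sqrt 2 \<le> \<gamma> * A" using A \<gamma> by (simp add: field_simps)
  have L0: "0 < ln (1 / \<delta>0)" using \<delta> by simp
  have log_pos: "0 < ln (2 * real ?p / real j)" if "j \<in> {1..?p}" for j
  proof -
    have "real j \<le> real ?p" "0 < real j" using that by auto
    then have "1 < 2 * real ?p / real j" by (simp add: less_divide_eq)
    then show ?thesis by simp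
  qed
  have log_mono: "ln (2 * real ?p / real j) \<le> ln (2 * real ?p / real i)"
    if "1 \<le> i" "i \<le> j" "j \<le> ?p" for i j
    using that by (subst ln_le_cancel_iff) (auto intro!: divide_left_mono divide_pos_pos)
  have lam: "slope_weights ?p lam"
    unfolding slope_weights_def
  proof (intro conjI allI ballI impI)
    fix j assume "j \<in> {1..?p}"
    then show "0 \<le> lam j" using lam_eq log_pos[of j] A0 \<sigma> by simp
  next
    fix i j :: nat assume "1 \<le> i" "i \<le> j" "j \<le> ?p"
    then show "lam j \<le> lam i"
      using lam_eq log_mono[of i j] A0 \<sigma> by (auto intro!: mult_left_mono real_sqrt_le_mono divide_right_mono)
  qed
  have lam_sq: "(lam j)\<^sup>2 = (A * \<sigma>)\<^sup>2 / ?n * ln (2 * real ?p / real j)" if "j \<in> {1..?p}" for j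
    using lam_eq that log_pos[OF that] by (simp add: power_mult_distrib)
  have S_pos: "0 < S s" if "s \<in> {1..?p}" for s
    unfolding S_def
  proof (rule sum_pos)
    fix j assume "j \<in> {1..s}"
    then have "j \<in> {1..?p}" using that by auto
    then show "0 < (lam j)\<^sup>2" using A0 \<sigma> log_pos[of j] by (simp add: lam_sq)
  qed (use that in auto)
  have B0: "0 \<le> B" using A0 \<sigma> L0 by (simp add: B_def)
  have BK: "B\<^sup>2 \<le> K s * S s" if s: "s \<in> {1..?p}" for s
  proof -
    \<comment> \<open>The last of the first \<open>s\<close> weights is the smallest.\<close>
    have "(\<Sum>j = 1..s. (A * \<sigma>)\<^sup>2 / ?n * ln (2 * real ?p / real s)) \<le> S s"
      unfolding S_def using s
      by (intro sum_mono) (auto simp: lam_sq intro!: mult_left_mono divide_right_mono log_mono)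
    then have "(A * \<sigma>)\<^sup>2 / ?n * (real s * ln (2 * real ?p / real s)) \<le> S s" by (simp add: mult_ac)
    then have "K s * ((A * \<sigma>)\<^sup>2 / ?n * (real s * ln (2 * real ?p / real s))) \<le> K s * S s"
      using L0 log_pos[OF s] by (intro mult_left_mono) (auto simp: K_def)
    moreover have "K s * ((A * \<sigma>)\<^sup>2 / ?n * (real s * ln (2 * real ?p / real s)))
        = (A * \<sigma>)\<^sup>2 / ?n * ln (1 / \<delta>0)"
      using log_pos[OF s] s by (simp add: K_def)
    moreover have "B\<^sup>2 = (A * \<sigma>)\<^sup>2 / ?n * ln (1 / \<delta>0)"
      using L0 by (simp add: B_def power_mult_distrib)
    ultimately show ?thesis by (simp only:)
  qed
  have N: "(1 / ?n) * (\<xi> \<omega> \<bullet> (X *v u)) \<le> \<gamma> * max (sorted_l1 lam u) (B * emp_norm (X *v u))"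
    if "\<omega> \<in> Omega" for \<omega> and u :: "real ^ 'p"
  proof -
    define M where "M = max (sorted_l1 lam u) (B * emp_norm (X *v u))"
    have M0: "0 \<le> M" using sorted_l1_nonneg[OF lam, of u] by (simp add: M_def le_max_iff_disj)
    have "A * H_fun \<sigma> X u = (4 + sqrt 2) * sorted_l1 lam u"
      unfolding H_fun_def sorted_l1_def using lam_eq by (simp add: sum_distrib_left mult_ac)
    moreover have "A * G_fun \<sigma> \<delta>0 X u = (4 + sqrt 2) * (B * emp_norm (X *v u))"
      by (simp add: G_fun_def B_def mult_ac)
    moreover have "(4 + sqrt 2) * x \<le> (4 + sqrt 2) * M" if "x \<le> M" for x
      using that by (intro mult_left_mono) auto
    ultimately have "A * max (H_fun \<sigma> X u) (G_fun \<sigma> \<delta>0 X u) \<le> (4 + sqrt 2) * M"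
      by (auto simp: max_def M_def)
    also have "\<dots> \<le> A * (\<gamma> * M)" using mult_right_mono[OF \<kappa> M0] by (simp add: mult_ac)
    finally have "max (H_fun \<sigma> X u) (G_fun \<sigma> \<delta>0 X u) \<le> \<gamma> * M" using A0 by simp
    then show ?thesis using that Om by (auto simp: M_def intro: order_trans)
  qed
  have pred: "ereal (2 * \<tau> * sorted_l1 lam (b - \<beta>) + (emp_norm (X *v b - f))\<^sup>2)
      \<le> ereal ((emp_norm (X *v \<beta> - f))\<^sup>2) + C_const X lam \<gamma> \<tau> s \<delta>0 * ereal (S s)"
    if \<omega>: "\<omega> \<in> Omega" and slope: "is_slope_estimator lam X (f + \<xi> \<omega>) b"
      and s: "s \<in> {1..?p}" and sparse: "l0 \<beta> \<le> s" for \<omega> f b s \<beta>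
  proof (cases "WRE X lam s (c0_const \<gamma> \<tau>)")
    case False
    \<comment> \<open>The right-hand side is infinite because the sum of squared weights is positive.\<close>
    then show ?thesis using S_pos[OF s] by (simp add: C_const_def)
  next
    case True
    have sp: "s \<le> ?p" using s by simp
    have \<theta>: "vartheta X lam s (c0_const \<gamma> \<tau>) > 0" using True by (simp add: WRE_def)
    have g: "0 \<le> \<gamma>" "\<gamma> + \<tau> < 1" using \<gamma> \<tau> by auto
    define E where "E = (1 + \<gamma> + \<tau>)\<^sup>2 * max (K s) (1 / (vartheta X lam s (c0_const \<gamma> \<tau>))\<^sup>2)"
    have C: "C_const X lam \<gamma> \<tau> s \<delta>0 = ereal E"
      using True by (simp add: C_const_def E_def K_def)
    have "2 * \<tau> * sorted_l1 lam (b - \<beta>) + (emp_norm (X *v b - f))\<^sup>2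
        \<le> (emp_norm (X *v \<beta> - f))\<^sup>2 + E * S s"
      using slope_basic_inequality[OF lam slope, of \<beta>]
        prediction_excess_le[OF lam sp sparse g(1) \<tau>(1) g(2) N[OF \<omega>, of "b - \<beta>"] refl BK[OF s, unfolded S_def] \<theta>,
          folded E_def S_def]
      by argo
    then show ?thesis by (simp add: C)
  qed
  have estim: "ereal (norm (b - \<beta>)) \<le> C_const X lam \<gamma> 0 s \<delta>0 / ereal (1 + \<gamma>) * ereal (sqrt (S s))"
    if \<omega>: "\<omega> \<in> Omega" and slope: "is_slope_estimator lam X (X *v \<beta> + \<xi> \<omega>) b"
      and s: "s \<in> {1..?p}" and sparse: "l0 \<beta> \<le> s" for \<omega> b s \<beta>
  proof (cases "WRE X lam s (c0_const \<gamma> 0)")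
    case False
    then show ?thesis using S_pos[OF s] \<gamma> by (simp add: C_const_def)
  next
    case True
    have sp: "s \<le> ?p" using s by simp
    have \<theta>: "vartheta X lam s (c0_const \<gamma> 0) > 0" using True by (simp add: WRE_def)
    have g: "0 \<le> \<gamma>" using \<gamma> by simp
    have "(emp_norm (X *v (b - \<beta>)))\<^sup>2
        \<le> (1 / ?n) * (\<xi> \<omega> \<bullet> (X *v (b - \<beta>))) + sorted_l1 lam \<beta> - sorted_l1 lam b"
      using slope_basic_inequality[OF lam slope, of \<beta>]
      by (simp add: matrix_vector_mult_diff_distrib[symmetric] emp_norm_sq[of 0])
    from estimation_error_le[OF lam sp sparse g \<gamma>(2) N[OF \<omega>, of "b - \<beta>"] this B0 BK[OF s, unfolded S_def]
        S_pos[OF s, unfolded S_def] \<theta>]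
    show ?thesis using True \<gamma> by (simp add: C_const_def K_def S_def power2_eq_square)
  qed
  show ?thesis
  proof (intro conjI ballI allI impI)
    fix \<omega> f and bhat \<beta> :: "real ^ 'p" and s
    assume "\<omega> \<in> Omega" "is_slope_estimator lam X (f + \<xi> \<omega>) bhat" "s \<in> {1..?p}" "l0 \<beta> = s"
    then show "ereal (2 * \<tau> * sorted_l1 lam (bhat - \<beta>) + (emp_norm (X *v bhat - f))\<^sup>2)
        \<le> ereal ((emp_norm (X *v \<beta> - f))\<^sup>2) + C_const X lam \<gamma> \<tau> s \<delta>0 * ereal (\<Sum>j = 1..s. (lam j)\<^sup>2)"
      using pred[of \<omega> f bhat s \<beta>] by (simp add: S_def)
  next
    fix s f \<omega> and \<beta>s bhat :: "real ^ 'p"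
    assume h: "s \<in> {1..?p}" "f = X *v \<beta>s" "l0 \<beta>s \<le> s" "\<omega> \<in> Omega"
      "is_slope_estimator lam X (f + \<xi> \<omega>) bhat"
    have "ereal (2 * \<tau> * sorted_l1 lam (bhat - \<beta>s))
        \<le> ereal (2 * \<tau> * sorted_l1 lam (bhat - \<beta>s) + (emp_norm (X *v bhat - f))\<^sup>2)" by simp
    also have "\<dots> \<le> C_const X lam \<gamma> \<tau> s \<delta>0 * ereal (\<Sum>j = 1..s. (lam j)\<^sup>2)"
      using pred[OF h(4,5,1,3)] h(2) by (simp add: S_def emp_norm_sq[of 0])
    finally show "ereal (2 * \<tau> * sorted_l1 lam (bhat - \<beta>s))
        \<le> C_const X lam \<gamma> \<tau> s \<delta>0 * ereal (\<Sum>j = 1..s. (lam j)\<^sup>2)" .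
    show "ereal (norm (bhat - \<beta>s))
        \<le> C_const X lam \<gamma> 0 s \<delta>0 / ereal (1 + \<gamma>) * ereal (sqrt (\<Sum>j = 1..s. (lam j)\<^sup>2))"
      using estim[OF h(4) h(5)[unfolded h(2)] h(1,3)] by (simp add: S_def)
  qed
qed

end
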